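(* For every integer $n\geq 1$ and every real $a\in(0,2)$, $\vec\chi(BG(n+1,a))\geq n+2$.
   Context: The Borsuk graph $BG(n+1,a)$ is the (infinite) undirected graph with vertex set $\mathbb S^n=\{x\in\mathbb R^{n+1}: \|x\|=1\}$ in which $x,y$ are adjacent iff $\|y-x\|\geq a$. For a digraph $D$, a proper $k$-colouring is a map $f:V(D)\to[k]$ such that each colour class induces a subdigraph with no directed cycle; the dichromatic number $\vec\chi(D)$ is the least $k$ admitting a proper $k$-colouring. For an undirected graph $G$, $\vec\chi(G)$ is the supremum of $\vec\chi(D)$ over all orientations $D$ of $G$. *)

theory Defs
  imports
    "HOL-Analysis.Analysis"
    "Graph_Theory.Digraph_Component"
    "Graph_Theory.Pair_Digraph"
begin

text \<open>
  As in the library, an undirected graph is a symmetric digraph: the edge between u and v is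
  represented by the two arcs (u, v) and (v, u).
\<close>

definition borsuk_graph :: "real \<Rightarrow> 'a::real_normed_vector pair_pre_digraph" where
  "borsuk_graph a =
     \<lparr> pverts = sphere 0 1,
       parcs = {(x, y). x \<in> sphere 0 1 \<and> y \<in> sphere 0 1 \<and> norm (y - x) \<ge> a} \<rparr>"

lemma borsuk_graph_bidirected:
  assumes "a > 0"
  shows "pair_bidirected_digraph (borsuk_graph a)"
  using assms
  by unfold_locales (auto simp: borsuk_graph_def symmetric_def sym_def norm_minus_commute)

definition orientation_of :: "'a pair_pre_digraph \<Rightarrow> 'a pair_pre_digraph \<Rightarrow> bool" where
  "orientation_of D G \<longleftrightarrow>
     pverts D = pverts G \<and> parcs D \<subseteq> parcs G \<and>
     (\<forall>(u, v) \<in> parcs G. ((u, v) \<in> parcs D) \<noteq> ((v, u) \<in> parcs D))"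

definition proper_dicolouring :: "('a, 'b) pre_digraph \<Rightarrow> nat \<Rightarrow> ('a \<Rightarrow> nat) \<Rightarrow> bool" where
  "proper_dicolouring D k f \<longleftrightarrow>
     f \<in> verts D \<rightarrow> {1..k} \<and>
     (\<forall>i \<in> {1..k}. \<nexists>p. pre_digraph.cycle (D \<restriction> {v \<in> verts D. f v = i}) p)"

text \<open>
  The values are extended naturals: a digraph without any finite proper colouring gets
  \<open>Inf {} = \<infinity>\<close>, and the supremum over all orientations may be infinite.
\<close>

definition dichromatic_number :: "('a, 'b) pre_digraph \<Rightarrow> enat" where
  "dichromatic_number D = (INF k \<in> {k. \<exists>f. proper_dicolouring D k f}. enat k)"

definition graph_dichromatic_number :: "'a pair_pre_digraph \<Rightarrow> enat" where
  "graph_dichromatic_number G =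
     (SUP D \<in> {D. orientation_of D G}. dichromatic_number (with_proj D))"

end

theory Submission
  imports Defs "HOL-Homology.Homology" "HOL-Library.Nat_Bijection"
begin

text \<open>
  Orient the Borsuk graph so that on a dense sequence of points of the sphere it is a universal
  tournament: near every point, every finite pattern of in- and out-neighbours is realized. For a
  colouring with \<open>n + 1\<close> colours, call a colour rich at \<open>x\<close> if it occurs infinitely often near \<open>x\<close> and,
  for every infinite set \<open>A\<close> of points of the sequence, contains \<open>b, b'\<close> arbitrarily near \<open>x\<close> with
  \<open>a \<rightarrow> b \<rightarrow> a' \<rightarrow> b' \<rightarrow> a\<close> for some \<open>a, a'\<close> in \<open>A\<close>. The sets of points at which a given colour is rich are
  closed, and by universality they cover the sphere. By the Lusternik--Schnirelmann theorem some colour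
  is rich at two antipodal points \<open>x\<close> and \<open>- x\<close>; taking for \<open>A\<close> the points of this colour near \<open>- x\<close> yields
  a monochromatic directed four-cycle.

  The Lusternik--Schnirelmann theorem follows from Borsuk's theorem that odd self-maps of spheres have
  odd degree, since a non-surjective map has degree zero.
\<close>

section \<open>Odd maps of spheres have odd degree\<close>

lemma topspace_nsphere: "topspace (nsphere n) = {x. (\<Sum>i\<le>n. (x i)\<^sup>2) = 1 \<and> (\<forall>i>n. x i = 0)}"
  by (simp add: nsphere)

definition normalize_upto :: "nat \<Rightarrow> (nat \<Rightarrow> real) \<Rightarrow> nat \<Rightarrow> real" where
  "normalize_upto n u = (\<lambda>i. u i / sqrt (\<Sum>j\<le>n. (u j)\<^sup>2))"

lemma sum_squares_pos:
  fixes u :: "nat \<Rightarrow> real"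
  assumes "\<exists>i\<le>n. u i \<noteq> 0"
  shows "(\<Sum>j\<le>n. (u j)\<^sup>2) > 0"
  using assms by (auto intro!: sum_pos2)

lemma normalize_upto_in_nsphere:
  assumes "\<exists>i\<le>n. u i \<noteq> 0" "\<And>i. i > n \<Longrightarrow> u i = 0"
  shows "normalize_upto n u \<in> topspace (nsphere n)"
  using assms(2) sum_squares_pos[OF assms(1)]
  by (auto simp: topspace_nsphere normalize_upto_def power_divide simp flip: sum_divide_distrib)

lemma normalize_upto_of_nsphere: "u \<in> topspace (nsphere n) \<Longrightarrow> normalize_upto n u = u"
  by (auto simp: topspace_nsphere normalize_upto_def)

lemma normalize_upto_minus: "normalize_upto n (\<lambda>i. - u i) = (\<lambda>i. - normalize_upto n u i)"
  by (simp add: normalize_upto_def)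

lemma continuous_map_normalize_upto:
  assumes cont: "\<And>i. i \<le> n \<Longrightarrow> continuous_map X euclideanreal (\<lambda>x. u x i)"
    and nz: "\<And>x. x \<in> topspace X \<Longrightarrow> \<exists>i\<le>n. u x i \<noteq> 0"
    and z: "\<And>x i. x \<in> topspace X \<Longrightarrow> i > n \<Longrightarrow> u x i = 0"
  shows "continuous_map X (nsphere n) (\<lambda>x. normalize_upto n (u x))"
proof -
  have "continuous_map X euclideanreal (\<lambda>x. normalize_upto n (u x) i)" for i
  proof (cases "i \<le> n")
    case True
    have "\<And>x. x \<in> topspace X \<Longrightarrow> sqrt (\<Sum>j\<le>n. (u x j)\<^sup>2) \<noteq> 0"
      using sum_squares_pos[OF nz] by fastforce
    then show ?thesis
      unfolding normalize_upto_def using True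
      by (intro continuous_intros cont) auto
  next
    case False
    then show ?thesis
      using z by (rule_tac continuous_map_eq[where f="\<lambda>x. 0::real"]) (auto simp: normalize_upto_def)
  qed
  moreover have "normalize_upto n (u x) \<in> topspace (nsphere n)" if "x \<in> topspace X" for x
    using normalize_upto_in_nsphere nz z that by blast
  ultimately show ?thesis
    unfolding nsphere continuous_map_in_subtopology continuous_map_componentwise_UNIV
    by (auto simp: nsphere)
qed

text \<open>A straight-line homotopy that never meets the origin can be projected radially to the
  sphere.\<close>

lemma homotopic_normalize_upto:
  assumes u: "\<And>i. i \<le> n \<Longrightarrow> continuous_map X euclideanreal (\<lambda>x. u x i)"
    and v: "\<And>i. i \<le> n \<Longrightarrow> continuous_map X euclideanreal (\<lambda>x. v x i)"
    and nz: "\<And>x t. x \<in> topspace X \<Longrightarrow> 0 \<le> t \<Longrightarrow> t \<le> 1 \<Longrightarrow> \<exists>i\<le>n. (1 - t) * u x i + t * v x i \<noteq> 0"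
    and z: "\<And>x i. x \<in> topspace X \<Longrightarrow> i > n \<Longrightarrow> u x i = 0 \<and> v x i = 0"
  shows "homotopic_with (\<lambda>x. True) X (nsphere n)
           (\<lambda>x. normalize_upto n (u x)) (\<lambda>x. normalize_upto n (v x))"
proof -
  let ?T = "top_of_set {0..1::real}"
  let ?h = "\<lambda>y i. (1 - fst y) * u (snd y) i + fst y * v (snd y) i"
  have "continuous_map (prod_topology ?T X) euclideanreal (\<lambda>y. ?h y i)" if "i \<le> n" for i
    using continuous_map_compose[OF continuous_map_snd u[OF that]]
      continuous_map_compose[OF continuous_map_snd v[OF that]]
    unfolding o_def
    by (intro continuous_map_into_fulltopology [OF continuous_map_fst] continuous_intros) auto
  then have "continuous_map (prod_topology ?T X) (nsphere n) (\<lambda>y. normalize_upto n (?h y))"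
    using nz z by (intro continuous_map_normalize_upto) auto
  then show ?thesis
    unfolding homotopic_with_def
    by (intro exI[of _ "\<lambda>y. normalize_upto n (?h y)"]) auto
qed

text \<open>The 0-sphere has two points, so an odd self-map is the identity or the antipodal map.
  Either is an involution, hence its degree squares to 1.\<close>

lemma odd_degree_nsphere_0:
  assumes cont: "continuous_map (nsphere 0) (nsphere 0) f"
    and f: "\<And>x. x \<in> topspace (nsphere 0) \<Longrightarrow> f (\<lambda>i. - x i) = (\<lambda>i. - f x i)"
  shows "odd (Brouwer_degree2 0 f)"
proof -
  have "(f \<circ> f) x = id x" if x: "x \<in> topspace (nsphere 0)" for x
  proof -
    have fx: "f x \<in> topspace (nsphere 0)"
      using cont x continuous_map_image_subset_topspace by blast
    have "y = x \<or> y = (\<lambda>i. - x i)" if "y \<in> topspace (nsphere 0)" for y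
    proof -
      have "x 0 = y 0 \<or> x 0 = - y 0"
        using x that by (auto simp: topspace_nsphere power2_eq_1_iff)
      moreover have "x i = 0" "y i = 0" if "i \<noteq> 0" for i
        using x \<open>y \<in> _\<close> that by (auto simp: topspace_nsphere)
      ultimately have "(\<forall>i. y i = x i) \<or> (\<forall>i. y i = - x i)"
        by (metis minus_minus neg_equal_0_iff_equal)
      then show ?thesis
        by (simp add: fun_eq_iff)
    qed
    from this[OF fx] consider "f x = x" | "f x = (\<lambda>i. - x i)"
      by blast
    then show ?thesis
      using f[OF x] by cases auto
  qed
  then have "Brouwer_degree2 0 (f \<circ> f) = 1"
    by (metis Brouwer_degree2_eq Brouwer_degree2_id)
  then have "Brouwer_degree2 0 f * Brouwer_degree2 0 f = 1"
    using Brouwer_degree2_compose[OF cont cont] by simp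
  then show ?thesis
    by (metis even_mult_iff odd_one)
qed

section \<open>Embedding sequence spheres into a Euclidean space\<close>

lemma nsphere_eq_top_of_set: "nsphere n = top_of_set (topspace (nsphere n))"
  by (simp add: nsphere euclidean_product_topology)

lemma continuous_map_nsphere_iff_continuous_on:
  "continuous_map (nsphere n) euclidean g \<longleftrightarrow> continuous_on (topspace (nsphere n)) g"
  by (metis nsphere_eq_top_of_set continuous_map_iff_continuous)

text \<open>The set lies in the frontier of the preimage of the unit ball under \<open>P\<close>,
  and the frontier of a convex set is negligible.\<close>

lemma negligible_cylinder:
  fixes P :: "'a::euclidean_space \<Rightarrow> 'b::euclidean_space"
  assumes P: "linear P"
  shows "negligible {v. norm (P v) = 1}"
proof (rule negligible_subset)
  let ?S = "{v. norm (P v) \<le> 1}"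
  have "?S = P -` cball 0 1"
    by auto
  then show "negligible (frontier ?S)"
    using convex_linear_vimage[OF P convex_cball] negligible_convex_frontier by metis
  show "{v. norm (P v) = 1} \<subseteq> frontier ?S"
  proof (clarsimp simp: frontier_def)
    fix v assume v: "norm (P v) = 1"
    have "v \<notin> interior ?S"
    proof
      assume "v \<in> interior ?S"
      then obtain e where e: "e > 0" "ball v e \<subseteq> ?S"
        by (meson mem_interior)
      \<comment> \<open>Stretching \<open>v\<close> by 1 + s moves it by less than \<open>e\<close>
        but lifts the norm of \<open>P v\<close> above 1.\<close>
      define s where "s = e / (2 * (norm v + 1))"
      have s: "s > 0" "s * norm v < e"
        using e(1) by (auto simp: s_def field_simps add_pos_nonneg intro: add_nonneg_pos)
      have "dist v ((1 + s) *\<^sub>R v) = s * norm v"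
        using s by (simp add: dist_norm algebra_simps)
      with s e have "norm (P ((1 + s) *\<^sub>R v)) \<le> 1"
        by (auto simp: subset_iff)
      then show False
        using s v by (simp add: linear_cmul[OF P])
    qed
    moreover have "v \<in> closure ?S"
      using v closure_subset by fastforce
    ultimately show "v \<in> closure ?S \<and> v \<notin> interior ?S"
      by blast
  qed
qed

lemma inner_enum_Basis:
  fixes b :: "nat \<Rightarrow> 'a::euclidean_space"
  assumes "bij_betw b {..<DIM('a)} Basis" "i < DIM('a)" "j < DIM('a)"
  shows "b i \<bullet> b j = (if i = j then 1 else 0)"
proof -
  have "b i \<in> Basis" "b j \<in> Basis" "b i = b j \<longleftrightarrow> i = j"
    using assms by (auto simp: bij_betw_def inj_on_eq_iff)
  then show ?thesis
    by (simp add: inner_Basis)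
qed

definition basis_comb :: "(nat \<Rightarrow> 'a::euclidean_space) \<Rightarrow> (nat \<Rightarrow> real) \<Rightarrow> 'a" where
  "basis_comb b x = (\<Sum>j<DIM('a). x j *\<^sub>R b j)"

lemma basis_comb_minus: "basis_comb b (\<lambda>i. - x i) = - basis_comb b x"
  by (simp add: basis_comb_def sum_negf)

lemma continuous_on_basis_comb: "continuous_on X (basis_comb b)"
proof -
  have "continuous_on X (\<lambda>x. x i :: real)" for i :: nat
    by (rule continuous_on_subset[OF continuous_on_product_coordinates]) simp
  then show ?thesis
    unfolding basis_comb_def by (intro continuous_intros)
qed

lemma basis_comb_inner:
  fixes b :: "nat \<Rightarrow> 'a::euclidean_space"
  assumes b: "bij_betw b {..<DIM('a)} Basis" and "i < DIM('a)"
  shows "basis_comb b x \<bullet> b i = x i"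
proof -
  have "basis_comb b x \<bullet> b i = (\<Sum>j<DIM('a). if j = i then x j else 0)"
    unfolding basis_comb_def inner_sum_left using \<open>i < DIM('a)\<close>
    by (intro sum.cong) (auto simp: inner_enum_Basis[OF b])
  then show ?thesis
    using \<open>i < DIM('a)\<close> by simp
qed

lemma norm_basis_comb_nsphere:
  fixes b :: "nat \<Rightarrow> 'a::euclidean_space"
  assumes b: "bij_betw b {..<DIM('a)} Basis" and m: "m < DIM('a)" and x: "x \<in> topspace (nsphere m)"
  shows "norm (basis_comb b x) = 1"
proof -
  have "(norm (basis_comb b x))\<^sup>2 = (\<Sum>u\<in>Basis. (basis_comb b x \<bullet> u)\<^sup>2)"
    unfolding power2_norm_eq_inner by (subst euclidean_inner) (simp add: power2_eq_square)
  also have "\<dots> = (\<Sum>i<DIM('a). (x i)\<^sup>2)"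
    using basis_comb_inner[OF b] by (subst sum.reindex_bij_betw[OF b, symmetric]) simp
  also have "\<dots> = (\<Sum>i\<le>m. (x i)\<^sup>2)"
    using x m by (intro sum.mono_neutral_right) (auto simp: topspace_nsphere)
  also have "\<dots> = 1"
    using x by (simp add: topspace_nsphere)
  finally show ?thesis
    by (metis norm_ge_zero one_power2 power2_eq_imp_eq zero_le_one)
qed

text \<open>The sphere is a closed subset of a product of intervals, which is compact by
  Tychonoff.\<close>

lemma compact_nsphere: "compact (topspace (nsphere n))"
proof -
  have "compactin (powertop_real UNIV) (PiE UNIV (\<lambda>i. {-1..1}))"
    by (simp add: compactin_PiE)
  then have "compact (PiE UNIV (\<lambda>i::nat. {-1..1::real}))"
    by (simp add: euclidean_product_topology)
  moreover have "closed (topspace (nsphere n))"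
    unfolding topspace_nsphere
    by (intro closed_Collect_conj closed_Collect_eq closed_Collect_all closed_Collect_imp
        continuous_intros continuous_on_product_coordinates) auto
  moreover have "topspace (nsphere n) \<subseteq> PiE UNIV (\<lambda>i. {-1..1})"
  proof
    fix x assume x: "x \<in> topspace (nsphere n)"
    have "\<bar>x i\<bar> \<le> 1" for i
    proof (cases "i \<le> n")
      case True
      then have "(x i)\<^sup>2 \<le> (\<Sum>j\<le>n. (x j)\<^sup>2)"
        by (intro member_le_sum) auto
      then show ?thesis
        using x by (simp add: topspace_nsphere abs_square_le_1)
    qed (use x in \<open>auto simp: topspace_nsphere\<close>)
    then show "x \<in> PiE UNIV (\<lambda>i. {-1..1})"
      by (auto simp: abs_le_iff minus_le_iff)
  qed
  ultimately show ?thesis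
    using compact_Int_closed by (metis inf.absorb_iff2)
qed

section \<open>Polynomial approximation and general position\<close>

text \<open>The ratios \<open>q i / q m\<close> map a sphere of dimension m - 1 into m-dimensional
  space, so their image is negligible and misses a point. To argue inside the full space
  \<open>'a\<close>, this map is extended by the identity in the remaining coordinates.\<close>

lemma polynomial_ratios_avoid_point:
  fixes b :: "nat \<Rightarrow> 'a::euclidean_space" and q :: "nat \<Rightarrow> 'a \<Rightarrow> real"
  assumes b: "bij_betw b {..<DIM('a)} Basis" and m: "m \<le> DIM('a)"
    and q: "\<And>i. i \<le> m \<Longrightarrow> real_polynomial_function (q i)"
  obtains c :: "nat \<Rightarrow> real" where
    "\<And>x. norm x = 1 \<Longrightarrow> \<forall>i\<in>{m..<DIM('a)}. x \<bullet> b i = 0 \<Longrightarrow> q m x \<noteq> 0 \<Longrightarrow>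
       \<exists>i<m. q i x \<noteq> q m x * c i"
proof -
  let ?N = "DIM('a)"
  define P where "P v = (\<Sum>i<m. (v \<bullet> b i) *\<^sub>R b i)" for v
  have bb: "b i \<bullet> b j = (if i = j then 1 else 0)" if "i < ?N" "j < ?N" for i j
    using inner_enum_Basis[OF b that] .
  have eqI: "v = w" if "\<And>i. i < ?N \<Longrightarrow> v \<bullet> b i = w \<bullet> b i" for v w
  proof (rule euclidean_eqI)
    fix u :: 'a assume "u \<in> Basis"
    then obtain i where "i < ?N" "u = b i"
      using b by (auto simp: bij_betw_def)
    then show "v \<bullet> u = w \<bullet> u" using that by simp
  qed
  have sumb: "(\<Sum>i<m. r i *\<^sub>R b i) \<bullet> b j = (if j < m then r j else 0)" if "j < ?N" for r j
  proof -
    have "(\<Sum>i<m. r i *\<^sub>R b i) \<bullet> b j = (\<Sum>i<m. if i = j then r i else 0)"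
      unfolding inner_sum_left using m that by (intro sum.cong) (auto simp: bb)
    then show ?thesis by simp
  qed
  have Pb: "P v \<bullet> b j = (if j < m then v \<bullet> b j else 0)" if "j < ?N" for v j
    using sumb[OF that] by (simp add: P_def)
  have lin: "linear P"
    unfolding P_def by (intro linearI) (auto simp: algebra_simps inner_add_left sum.distrib scaleR_sum_right)
  define D where "D = {v. norm (P v) = 1 \<and> q m (P v) \<noteq> 0}"
  define F where "F v = (\<Sum>i<m. (q i (P v) / q m (P v)) *\<^sub>R b i) + (v - P v)" for v
  have diffq: "(\<lambda>v. q i (P v)) differentiable at v" if "i \<le> m" for i v
    using differentiable_chain_at[of P v "q i"] differentiable_at_real_polynomial_function[OF q[OF that]]
      linear_imp_differentiable[OF lin] by (auto simp: o_def)
  have "(\<lambda>v. (q i (P v) / q m (P v)) *\<^sub>R b i) differentiable at v" if "v \<in> D" "i < m" for v i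
    using that by (intro differentiable_scaleR differentiable_divide diffq differentiable_const) (auto simp: D_def)
  then have "F differentiable at v" if "v \<in> D" for v
    unfolding F_def using that linear_imp_differentiable[OF lin]
    by (intro differentiable_add differentiable_sum differentiable_diff differentiable_ident) auto
  then have "F differentiable_on D"
    by (simp add: differentiable_on_def differentiable_at_withinI)
  moreover have "negligible D"
    by (rule negligible_subset[OF negligible_cylinder[OF lin]]) (auto simp: D_def)
  ultimately have "negligible (F ` D)"
    by (intro negligible_differentiable_image_negligible) auto
  then obtain p where p: "p \<notin> F ` D"
    by (metis UNIV_eq_I non_negligible_UNIV)
  show thesis
  proof (rule that)
    fix x
    assume x: "norm x = 1" "\<forall>i\<in>{m..<?N}. x \<bullet> b i = 0" and qx: "q m x \<noteq> 0"
    show "\<exists>i<m. q i x \<noteq> q m x * (p \<bullet> b i)"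
    proof (rule ccontr)
      assume "\<not> ?thesis"
      then have eq: "q i x / q m x = p \<bullet> b i" if "i < m" for i
        using that qx by auto
      \<comment> \<open>\<open>v\<close> takes its first m coordinates from \<open>x\<close> and the
        others from \<open>p\<close>; if the ratios at \<open>x\<close> gave the first coordinates
        of \<open>p\<close>, then \<open>F v\<close> would be the omitted point
        \<open>p\<close>.\<close>
      define v where "v = x + (p - P p)"
      have Pv: "P v = x"
        by (rule eqI) (auto simp: Pb v_def inner_add_left inner_diff_left x(2))
      have "F v = p"
        unfolding F_def Pv by (rule eqI) (auto simp: v_def inner_add_left inner_diff_left sumb Pb eq x(2))
      moreover have "v \<in> D"
        by (simp add: D_def Pv x qx)
      ultimately show False
        using p by blast
    qed
  qed
qed

lemma odd_map_odd_polynomial_approximation: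
  fixes b :: "nat \<Rightarrow> 'a::euclidean_space"
  assumes b: "bij_betw b {..<DIM('a)} Basis" and m: "m < DIM('a)" and "e > 0"
    and cont: "continuous_map (nsphere m) (nsphere m) f"
    and f: "\<And>x. x \<in> topspace (nsphere m) \<Longrightarrow> f (\<lambda>i. - x i) = (\<lambda>i. - f x i)"
  obtains q :: "nat \<Rightarrow> 'a \<Rightarrow> real" where
    "\<And>i. real_polynomial_function (q i)" "\<And>i v. q i (- v) = - q i v"
    "\<And>i x. x \<in> topspace (nsphere m) \<Longrightarrow> \<bar>f x i - q i (basis_comb b x)\<bar> < e"
proof -
  let ?N = "DIM('a)"
  let ?emb = "basis_comb b"
  \<comment> \<open>\<open>co\<close> inverts \<open>basis_comb b\<close> on the embedded sphere, so
    that \<open>f\<close> becomes a function on a compact subset of \<open>'a\<close>.\<close>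
  define co where "co v = (\<lambda>i. if i < ?N then v \<bullet> b i else 0)" for v
  have co_emb: "co (?emb x) = x" if "x \<in> topspace (nsphere m)" for x
  proof
    fix i
    show "co (?emb x) i = x i"
    proof (cases "i < ?N")
      case True
      then show ?thesis
        using basis_comb_inner[OF b] by (simp add: co_def)
    next
      case False
      then show ?thesis
        using that m by (auto simp: co_def topspace_nsphere)
    qed
  qed
  define S where "S = ?emb ` topspace (nsphere m)"
  have cS: "compact S"
    unfolding S_def using compact_continuous_image[OF continuous_on_basis_comb compact_nsphere] .
  have "continuous_on S (\<lambda>v. co v i)" for i
    by (cases "i < ?N") (auto simp: co_def intro!: continuous_intros)
  then have cont_co: "continuous_on S co"
    by (rule continuous_on_coordinatewise_then_product)
  have co_S: "co ` S \<subseteq> topspace (nsphere m)"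
    unfolding S_def by (auto simp: co_emb)
  have "continuous_on (topspace (nsphere m)) (\<lambda>x. f x i)" for i
    using continuous_map_compose[OF cont continuous_map_nsphere_projection, of i]
    by (simp add: o_def continuous_map_nsphere_iff_continuous_on)
  then have "continuous_on S (\<lambda>v. f (co v) i)" for i
    using continuous_on_compose2[OF _ cont_co co_S] by blast
  then have "\<exists>g. real_polynomial_function g \<and> (\<forall>v\<in>S. \<bar>f (co v) i - g v\<bar> < e)" for i
    using Stone_Weierstrass_real_polynomial_function[OF cS _ \<open>e > 0\<close>] by metis
  then obtain g where g: "\<And>i. real_polynomial_function (g i)"
    "\<And>i v. v \<in> S \<Longrightarrow> \<bar>f (co v) i - g i v\<bar> < e"
    by metis
  \<comment> \<open>Passing to the odd part keeps the error bound: since \<open>f\<close> is odd,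
    the new error is the mean of the errors at \<open>x\<close> and \<open>- x\<close>.\<close>
  define q where "q i v = (g i v - g i (- v)) / 2" for i v
  show thesis
  proof (rule that)
    have "real_polynomial_function (\<lambda>v. g i (- v))" for i
      using real_polynomial_function_compose[OF polynomial_function_minus[OF polynomial_function_id] g(1)]
      by (simp add: o_def)
    then show "real_polynomial_function (q i)" for i
      unfolding q_def using g(1) by (intro real_polynomial_function_divide real_polynomial_function_diff)
    show "q i (- v) = - q i v" for i v
      by (simp add: q_def field_simps)
    fix i x assume x: "x \<in> topspace (nsphere m)"
    have nx: "(\<lambda>i. - x i) \<in> topspace (nsphere m)"
      using x by (simp add: topspace_nsphere)
    have "\<bar>f x i - g i (?emb x)\<bar> < e" "\<bar>- f x i - g i (- ?emb x)\<bar> < e"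
      using g(2)[of "?emb x" i] g(2)[of "?emb (\<lambda>i. - x i)" i] x nx f[OF x]
      by (auto simp: co_emb S_def simp flip: basis_comb_minus)
    then show "\<bar>f x i - q i (basis_comb b x)\<bar> < e"
      unfolding q_def by (simp add: abs_less_iff field_simps)
  qed
qed

text \<open>
  The type \<open>'a\<close> only provides a Euclidean space of sufficient dimension for polynomial approximation and
  negligible sets. To apply the degree step, a polynomial approximation \<open>Q\<close> is deformed into
  the map with components \<open>Q\<^sub>i - Q\<^sub>m c\<^sub>i\<close> (\<open>i < m\<close>) and \<open>\<bar>x\<^sub>m\<bar> Q\<^sub>m\<close>,
  which preserves the equator \<open>x\<^sub>m = 0\<close>; it has no zero since \<open>c\<close> is chosen
  outside the image of the equator under the ratios \<open>Q\<^sub>i / Q\<^sub>m\<close>.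
\<close>

theorem Borsuk_odd_map_degree:
  assumes "m < DIM('a::euclidean_space)"
    and "continuous_map (nsphere m) (nsphere m) f"
    and "\<And>x. x \<in> topspace (nsphere m) \<Longrightarrow> f (\<lambda>i. - x i) = (\<lambda>i. - f x i)"
  shows "odd (Brouwer_degree2 m f)"
  using assms
proof (induction m arbitrary: f)
  case 0
  then show ?case
    using odd_degree_nsphere_0 by blast
next
  case (Suc k)
  let ?N = "DIM('a)"
  define m where "m = Suc k"
  note m = Suc.prems(1)[folded m_def] and cont = Suc.prems(2)[folded m_def]
    and f = Suc.prems(3)[folded m_def]
  obtain b :: "nat \<Rightarrow> 'a" where b: "bij_betw b {..<?N} Basis"
    by (metis atLeast0LessThan ex_bij_betw_nat_finite finite_Basis)
  obtain q :: "nat \<Rightarrow> 'a \<Rightarrow> real" where q: "\<And>i. real_polynomial_function (q i)"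
      "\<And>i v. q i (- v) = - q i v"
    and q_approx: "\<And>i x. x \<in> topspace (nsphere m) \<Longrightarrow>
            \<bar>f x i - q i (basis_comb b x)\<bar> < 1 / real (Suc m)"
    using odd_map_odd_polynomial_approximation[OF b m _ cont f, of "1 / real (Suc m)"] by auto
  obtain c where c: "\<And>x. norm x = 1 \<Longrightarrow> \<forall>i\<in>{m..<?N}. x \<bullet> b i = 0 \<Longrightarrow> q m x \<noteq> 0 \<Longrightarrow>
       \<exists>i<m. q i x \<noteq> q m x * c i"
    using polynomial_ratios_avoid_point[where q=q, OF b less_imp_le[OF m] q(1)] by blast
  let ?emb = "basis_comb b"
  define Q where "Q x i = (if i \<le> m then q i (?emb x) else 0)" for x i
  define R where "R x i = (if i < m then Q x i - Q x m * c i else \<bar>x m\<bar> * Q x i)" for x i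
  have Q_minus: "Q (\<lambda>i. - x i) = (\<lambda>i. - Q x i)" for x
    by (auto simp: Q_def basis_comb_minus q)
  \<comment> \<open>The factor in the last component is the absolute value of \<open>x m\<close>, an
    even function; with \<open>x m\<close> itself that component would become even.\<close>
  have R_minus: "R (\<lambda>i. - x i) = (\<lambda>i. - R x i)" for x
    by (auto simp: R_def Q_minus)
  have f_in: "f x \<in> topspace (nsphere m)" if "x \<in> topspace (nsphere m)" for x
    using cont that continuous_map_image_subset_topspace by blast
  \<comment> \<open>If the segment met the origin, all m + 1 coordinates of \<open>f x\<close> would
    be below 1 / (m + 1) in absolute value, and their squares would sum to less than 1.\<close>
  have fQ: "\<exists>i\<le>m. (1 - t) * f x i + t * Q x i \<noteq> 0"
    if x: "x \<in> topspace (nsphere m)" and t: "0 \<le> t" "t \<le> 1" for x t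
  proof (rule ccontr)
    assume "\<not> ?thesis"
    then have 0: "f x i = t * (f x i - Q x i)" if "i \<le> m" for i
      using that by (auto simp: algebra_simps)
    have "(f x i)\<^sup>2 < 1 / real (Suc m)" if "i \<le> m" for i
    proof -
      have "\<bar>f x i\<bar> = t * \<bar>f x i - Q x i\<bar>"
        by (subst 0[OF that]) (simp add: abs_mult t)
      also have "\<dots> \<le> \<bar>f x i - Q x i\<bar>"
        using t by (simp add: mult_left_le_one_le)
      also have "\<dots> < 1 / real (Suc m)"
        using q_approx[OF x, of i] that by (simp add: Q_def)
      finally have lt: "\<bar>f x i\<bar> < 1 / real (Suc m)" .
      have "(f x i)\<^sup>2 = \<bar>f x i\<bar> * \<bar>f x i\<bar>"
        by (simp add: power2_eq_square)
      also have "\<dots> \<le> \<bar>f x i\<bar> * 1"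
      proof (intro mult_left_mono)
        have "1 / real (Suc m) \<le> 1"
          by simp
        then show "\<bar>f x i\<bar> \<le> 1"
          using lt by linarith
      qed simp
      finally show ?thesis
        using lt by simp
    qed
    then have "(\<Sum>i\<le>m. (f x i)\<^sup>2) < (\<Sum>i\<le>m. 1 / real (Suc m))"
      by (intro sum_strict_mono) auto
    also have "\<dots> = 1"
      by simp
    finally show False
      using f_in[OF x] by (simp add: topspace_nsphere)
  qed
  \<comment> \<open>At a zero, the first m coordinates give Q_i = t Q_m c_i, so Q_m = 0 would make
    \<open>Q\<close> vanish. The last coordinate then forces t = 1 and x_m = 0: a point of the
    equator whose ratios are \<open>c\<close>.\<close>
  have QR: "\<exists>i\<le>m. (1 - t) * Q x i + t * R x i \<noteq> 0"
    if x: "x \<in> topspace (nsphere m)" and t: "0 \<le> t" "t \<le> 1" for x t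
  proof (rule ccontr)
    assume "\<not> ?thesis"
    then have 0: "(1 - t) * Q x i + t * R x i = 0" if "i \<le> m" for i
      using that by auto
    have i: "Q x i = t * Q x m * c i" if "i < m" for i
      using 0[of i] that by (simp add: R_def algebra_simps)
    have Qm: "Q x m \<noteq> 0"
    proof
      assume "Q x m = 0"
      then have "Q x j = 0" if "j \<le> m" for j
        using i that by (cases "j = m") auto
      then show False
        using fQ[OF x, of 1] by auto
    qed
    have "((1 - t) + t * \<bar>x m\<bar>) * Q x m = 0"
      using 0[of m] by (simp add: R_def algebra_simps)
    then have "(1 - t) + t * \<bar>x m\<bar> = 0"
      using Qm by simp
    then have "1 - t = 0" "t * \<bar>x m\<bar> = 0"
      using t add_nonneg_eq_0_iff[of "1 - t" "t * \<bar>x m\<bar>"] by auto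
    then have t1: "t = 1" and xm: "x m = 0"
      by auto
    have "\<exists>i<m. q i (?emb x) \<noteq> q m (?emb x) * c i"
    proof (rule c[OF norm_basis_comb_nsphere[OF b m x]])
      show "\<forall>i\<in>{m..<?N}. ?emb x \<bullet> b i = 0"
        using x xm by (auto simp: basis_comb_inner[OF b] topspace_nsphere le_less)
      show "q m (?emb x) \<noteq> 0"
        using Qm by (simp add: Q_def)
    qed
    then show False
      using i t1 by (auto simp: Q_def)
  qed
  have cont_Q: "continuous_map (nsphere m) euclideanreal (\<lambda>x. Q x i)" if "i \<le> m" for i
    using continuous_on_compose2[OF continuous_on_polymonial_function[of "q i" UNIV]
        continuous_on_basis_comb[of "topspace (nsphere m)" b]] q(1) that
    by (simp add: Q_def continuous_map_nsphere_iff_continuous_on real_polynomial_function_eq)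
  have cont_R: "continuous_map (nsphere m) euclideanreal (\<lambda>x. R x i)" if "i \<le> m" for i
    using that unfolding R_def
    by (cases "i < m") (auto intro!: continuous_intros cont_Q continuous_map_nsphere_projection)
  have cont_f: "continuous_map (nsphere m) euclideanreal (\<lambda>x. f x i)" for i
    using continuous_map_compose[OF cont continuous_map_nsphere_projection, of i] by (simp add: o_def)
  have z: "f x i = 0 \<and> Q x i = 0 \<and> R x i = 0" if "x \<in> topspace (nsphere m)" "i > m" for x i
    using f_in that by (auto simp: Q_def R_def topspace_nsphere)
  define F where "F x = normalize_upto m (R x)" for x
  have "homotopic_with (\<lambda>x. True) (nsphere m) (nsphere m) (\<lambda>x. normalize_upto m (f x)) (\<lambda>x. normalize_upto m (Q x))"
    using fQ z by (intro homotopic_normalize_upto cont_f cont_Q) auto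
  moreover have "homotopic_with (\<lambda>x. True) (nsphere m) (nsphere m) (\<lambda>x. normalize_upto m (Q x)) F"
    unfolding F_def using QR z by (intro homotopic_normalize_upto cont_R cont_Q) auto
  ultimately have "Brouwer_degree2 m (\<lambda>x. normalize_upto m (f x)) = Brouwer_degree2 m F"
    by (metis Brouwer_degree2_homotopic)
  moreover have "Brouwer_degree2 m (\<lambda>x. normalize_upto m (f x)) = Brouwer_degree2 m f"
    using f_in by (intro Brouwer_degree2_eq normalize_upto_of_nsphere)
  ultimately have deg_eq: "Brouwer_degree2 m f = Brouwer_degree2 m F"
    by simp
  have R_nz: "\<exists>i\<le>m. R x i \<noteq> 0" if "x \<in> topspace (nsphere m)" for x
    using QR[OF that, of 1] by simp
  have cont_F: "continuous_map (nsphere m) (nsphere m) F"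
    unfolding F_def using R_nz z by (intro continuous_map_normalize_upto cont_R) auto
  have F_minus: "F (\<lambda>i. - x i) = (\<lambda>i. - F x i)" for x
    by (simp add: F_def R_minus normalize_upto_minus)
  have equator: "nsphere k = subtopology (nsphere m) {x. x m = 0}"
    by (simp add: m_def subtopology_nsphere_equator)
  have F_equator: "F \<in> topspace (nsphere k) \<rightarrow> topspace (nsphere k)"
  proof
    fix x assume "x \<in> topspace (nsphere k)"
    then have x: "x \<in> topspace (nsphere m)" "x m = 0"
      by (auto simp: equator)
    then have "F x \<in> topspace (nsphere m)" "F x m = 0"
      using cont_F continuous_map_image_subset_topspace by (blast, simp add: F_def normalize_upto_def R_def)
    then show "F x \<in> topspace (nsphere k)"
      by (simp add: equator)
  qed
  \<comment> \<open>An odd map preserving the equator has the same degree parity as its restriction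
    to the equator, which the induction hypothesis covers.\<close>
  have "even (Brouwer_degree2 m F - Brouwer_degree2 (m - Suc 0) F)"
    using F_equator F_minus
    by (intro Borsuk_odd_mapping_degree_step cont_F) (auto simp: m_def)
  then have ev: "even (Brouwer_degree2 m F - Brouwer_degree2 k F)"
    by (simp add: m_def)
  have "continuous_map (nsphere k) (nsphere k) F"
    using continuous_map_from_subtopology[OF cont_F] F_equator
    by (auto simp: equator continuous_map_in_subtopology)
  then have "odd (Brouwer_degree2 k F)"
    using Suc.IH[of F] Suc.prems(1) F_minus by auto
  then show ?case
    using ev deg_eq by (simp add: m_def)
qed

section \<open>The Lusternik--Schnirelmann theorem\<close>

text \<open>Without an antipodal pair, comparing the distances of x and -x to all sets but the last
  gives an odd map without zeros. Its last coordinate is 0, so after normalization it misses a pole,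
  contradicting odd degree.\<close>

theorem Lusternik_Schnirelmann:
  fixes A :: "nat \<Rightarrow> 'a::euclidean_space set"
  assumes closed: "\<And>i. i < DIM('a) \<Longrightarrow> closed (A i)"
    and cover: "sphere 0 1 \<subseteq> (\<Union>i<DIM('a). A i)"
  obtains i x where "i < DIM('a)" "x \<in> sphere 0 1" "x \<in> A i" "- x \<in> A i"
proof (rule ccontr)
  assume "\<not> thesis"
  with that have no_antipodes: "- x \<notin> A i" if "i < DIM('a)" "norm x = 1" "x \<in> A i" for i x
    using that by auto
  define n where "n = DIM('a) - 1"
  have n: "DIM('a) = Suc n"
    using DIM_positive[where 'a='a] by (simp add: n_def)
  obtain b :: "nat \<Rightarrow> 'a" where b: "bij_betw b {..<DIM('a)} Basis"
    by (metis atLeast0LessThan ex_bij_betw_nat_finite finite_Basis)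
  let ?emb = "basis_comb b"
  define h where "h x i = (if i < n then infdist (?emb x) (A i) - infdist (- ?emb x) (A i) else 0)" for x i
  have nz: "\<exists>i\<le>n. h x i \<noteq> 0" if x: "x \<in> topspace (nsphere n)" for x
  proof (rule ccontr)
    assume "\<not> ?thesis"
    then have eq: "infdist (?emb x) (A i) = infdist (- ?emb x) (A i)" if "i < n" for i
      using that unfolding h_def by (metis (full_types) eq_iff_diff_eq_0 less_imp_le)
    have norm: "norm (?emb x) = 1"
      using norm_basis_comb_nsphere[OF b _ x] n by simp
    have notin: "?emb x \<notin> A i" "- ?emb x \<notin> A i" if "i < n" for i
    proof -
      \<comment> \<open>For a nonempty closed set, membership means distance 0; for an empty one,
        both sides are false.\<close>
      have "(?emb x \<in> A i) = (- ?emb x \<in> A i)"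
        using eq[OF that] closed[of i] that n in_closed_iff_infdist_zero[of "A i"]
        by (metis empty_iff less_SucI)
      then show "?emb x \<notin> A i" "- ?emb x \<notin> A i"
        using no_antipodes[of i "?emb x"] norm that n by auto
    qed
    \<comment> \<open>The last set does not enter \<open>h\<close>: it must contain whatever the
      other sets leave uncovered, here both antipodes.\<close>
    have "?emb x \<in> (\<Union>i<Suc n. A i)" "- ?emb x \<in> (\<Union>i<Suc n. A i)"
      using cover norm n by (auto simp: subset_iff)
    then have "?emb x \<in> A n" "- ?emb x \<in> A n"
      using notin by (auto simp: less_Suc_eq)
    then show False
      using no_antipodes[of n] norm n by auto
  qed
  define F where "F x = normalize_upto n (h x)" for x
  have "continuous_map (nsphere n) euclideanreal (\<lambda>x. h x i)" for i
    by (cases "i < n") (auto simp: h_def continuous_map_nsphere_iff_continuous_on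
        intro!: continuous_intros continuous_on_basis_comb)
  then have cont: "continuous_map (nsphere n) (nsphere n) F"
    unfolding F_def using nz by (intro continuous_map_normalize_upto) (auto simp: h_def)
  have "h (\<lambda>i. - x i) = (\<lambda>i. - h x i)" for x
    by (auto simp: h_def basis_comb_minus)
  then have "F (\<lambda>i. - x i) = (\<lambda>i. - F x i)" for x
    by (simp add: F_def normalize_upto_minus)
  then have "odd (Brouwer_degree2 n F)"
    using cont n by (intro Borsuk_odd_map_degree[where 'a='a]) auto
  moreover have "F ` topspace (nsphere n) \<noteq> topspace (nsphere n)"
  proof -
    define p :: "nat \<Rightarrow> real" where "p i = (if i = n then 1 else 0)" for i
    have "p \<in> topspace (nsphere n)"
      by (simp add: topspace_nsphere p_def if_distrib[of "\<lambda>x. x\<^sup>2"] cong: if_cong)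
    moreover have "F x n = 0" for x
      by (simp add: F_def h_def normalize_upto_def)
    then have "p \<notin> range F"
      by (metis p_def rangeE zero_neq_one)
    ultimately show ?thesis
      by blast
  qed
  then have "Brouwer_degree2 n F = 0"
    using Brouwer_degree2_nonsurjective[OF cont] by blast
  ultimately show False
    by simp
qed

section \<open>A universal tournament on a dense sequence\<close>

text \<open>
  The larger of two indices \<open>j = prod_encode (m, q)\<close> dictates the direction of the arc: \<open>q\<close> codes the
  finite set of smaller indices that point to \<open>j\<close>, and \<open>m\<close> selects the region of the sphere in which
  the \<open>j\<close>-th point is placed. Hence every finite in/out pattern recurs near every point.
\<close>

definition coded_arc :: "nat \<Rightarrow> nat \<Rightarrow> bool" where
  "coded_arc i j \<longleftrightarrow>
     i < j \<and> i \<in> set_decode (snd (prod_decode j)) \<or>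
     j < i \<and> j \<notin> set_decode (snd (prod_decode i))"

lemma coded_arc_asym: "coded_arc i j \<Longrightarrow> \<not> coded_arc j i"
  by (auto simp: coded_arc_def)

lemma coded_arc_realizes:
  assumes fin: "finite X" "finite Y" and disj: "X \<inter> Y = {}"
  obtains j where "fst (prod_decode j) = m" "j > N" "\<And>i. i \<in> X \<Longrightarrow> coded_arc i j"
    "\<And>i. i \<in> Y \<Longrightarrow> coded_arc j i"
proof -
  define M where "M = Suc (Max (insert N (X \<union> Y)))"
  have M: "N < M" "\<And>i. i \<in> X \<union> Y \<Longrightarrow> i < M"
    using fin by (auto simp: M_def less_Suc_eq_le intro!: Max_ge)
  \<comment> \<open>Inserting \<open>M\<close>, which exceeds \<open>N\<close> and all of
    \<open>X\<close> and \<open>Y\<close>, makes the code at least 2^M. So the new index lies above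
    all of them, and the pattern on \<open>X\<close> and \<open>Y\<close> is unaffected.\<close>
  define q where "q = set_encode (insert M X)"
  have "M < 2 ^ M"
    by simp
  also have "2 ^ M \<le> q"
    unfolding q_def set_encode_def using fin member_le_sum[of M "insert M X" "power 2 :: nat \<Rightarrow> nat"] by simp
  also have "q \<le> prod_encode (m, q)"
    by (rule le_prod_encode_2)
  finally have j: "M < prod_encode (m, q)" .
  have dec: "set_decode q = insert M X"
    using fin by (simp add: q_def set_encode_inverse)
  show thesis
  proof (rule that)
    show "fst (prod_decode (prod_encode (m, q))) = m" "N < prod_encode (m, q)"
      using j M by auto
    show "coded_arc i (prod_encode (m, q))" if "i \<in> X" for i
      using that M(2)[of i] j by (auto simp: coded_arc_def dec)
    show "coded_arc (prod_encode (m, q)) i" if "i \<in> Y" for i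
      using that M(2)[of i] j disj by (auto simp: coded_arc_def dec)
  qed
qed

text \<open>A connected space with at least two points has no isolated point.\<close>

lemma infinite_sphere_Int_ball:
  fixes p :: "'a::euclidean_space"
  assumes "2 \<le> DIM('a)" "p \<in> sphere 0 1" "r > 0"
  shows "infinite (sphere 0 1 \<inter> ball p r)"
proof -
  have conn: "Topological_Spaces.connected (sphere (0::'a) 1)"
    using assms(1) by (rule connected_sphere)
  have "- p \<noteq> p"
  proof
    assume "- p = p"
    then have "2 *\<^sub>R p = 0"
      by (metis scaleR_2 add.left_inverse)
    then show False
      using assms(2) by auto
  qed
  moreover have "- p \<in> sphere 0 1"
    using assms(2) by simp
  ultimately have "sphere (0::'a) 1 \<noteq> {x}" for x
    using assms(2) by (metis singletonD)
  then have "p islimpt sphere 0 1"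
    by (rule connected_imp_perfect[OF conn assms(2)])
  then show ?thesis
    using assms(3) by (simp add: islimpt_eq_infinite_ball)
qed

text \<open>The set \<open>Z\<close> of forbidden indices allows finitely many exceptions to be
  discarded later.\<close>

lemma coded_sphere_sequence:
  assumes "2 \<le> DIM('a::euclidean_space)"
  obtains e :: "nat \<Rightarrow> 'a::euclidean_space" where "inj e" "range e \<subseteq> sphere 0 1"
    "\<And>x \<epsilon> X Y Z. \<lbrakk>x \<in> sphere 0 1; 0 < \<epsilon>; finite X; finite Y; finite Z; X \<inter> Y = {}\<rbrakk> \<Longrightarrow>
       \<exists>j. e j \<in> ball x \<epsilon> \<and> j \<notin> Z \<and> (\<forall>i\<in>X. coded_arc i j) \<and> (\<forall>i\<in>Y. coded_arc j i)"
proof -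
  obtain T :: "'a set" where T: "countable T" "T \<subseteq> sphere 0 1" "sphere 0 1 \<subseteq> closure T"
    using separable[of "sphere 0 1"] by metis
  have "sphere (0::'a) 1 \<noteq> {}"
    by simp
  then have "T \<noteq> {}"
    using T(3) by auto
  define d where "d = from_nat_into T"
  have d: "range d = T"
    using T(1) \<open>T \<noteq> {}\<close> by (simp add: d_def)
  have dm: "d m \<in> sphere 0 1" for m
    using d T(2) by blast
  \<comment> \<open>The first component of the index selects a target in the dense set. The
    shrinking radius brings large indices with the same target arbitrarily close to it, and avoiding
    earlier points gives injectivity.\<close>
  define P where "P f j r \<longleftrightarrow> r \<in> sphere 0 1 \<and> r \<in> ball (d (fst (prod_decode j))) (1 / real (Suc j)) \<and>
      r \<notin> f ` {..<j}" for f :: "nat \<Rightarrow> 'a" and j r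
  have "\<exists>e. \<forall>j. P e j (e j)"
  proof (rule dependent_wellorder_choice)
    show "P f j r = P g j r" if "\<And>i. i < j \<Longrightarrow> f i = g i" for r f g j
    proof -
      have "f ` {..<j} = g ` {..<j}"
        using that by (intro image_cong) auto
      then show ?thesis
        by (simp add: P_def)
    qed
    show "\<exists>r. P f j r" for j f
    proof -
      have "infinite (sphere 0 1 \<inter> ball (d (fst (prod_decode j))) (1 / real (Suc j)) - f ` {..<j})"
        using infinite_sphere_Int_ball[OF assms dm] by (intro Diff_infinite_finite) auto
      then obtain r where "r \<in> sphere 0 1 \<inter> ball (d (fst (prod_decode j))) (1 / real (Suc j)) - f ` {..<j}"
        by (metis ex_in_conv finite.emptyI)
      then show ?thesis
        unfolding P_def by blast
    qed
  qed
  then obtain e where e: "\<And>j. P e j (e j)"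
    by blast
  show thesis
  proof (rule that)
    show "inj e"
    proof (rule linorder_injI)
      fix i j :: nat assume "i < j"
      then show "e i \<noteq> e j"
        using e[of j] unfolding P_def by (metis imageI lessThan_iff)
    qed
    show "range e \<subseteq> sphere 0 1"
      using e unfolding P_def by blast
    fix x :: 'a and \<epsilon> :: real and X Y Z :: "nat set"
    assume x: "x \<in> sphere 0 1" and \<epsilon>: "0 < \<epsilon>" and fin: "finite X" "finite Y" "finite Z" and disj: "X \<inter> Y = {}"
    obtain m where m: "dist (d m) x < \<epsilon> / 2"
      using T(3) x \<epsilon> d closure_approachable[of x T] by (metis half_gt_zero rangeE subsetD)
    obtain M where M: "1 / real (Suc M) < \<epsilon> / 2"
      using \<epsilon> nat_approx_posE[of "\<epsilon> / 2"] by auto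
    obtain j where j: "fst (prod_decode j) = m" "j > Max (insert M Z)"
        "\<And>i. i \<in> X \<Longrightarrow> coded_arc i j" "\<And>i. i \<in> Y \<Longrightarrow> coded_arc j i"
      using coded_arc_realizes[OF fin(1,2) disj] by metis
    have "j > M" "j \<notin> Z"
      using j(2) fin(3) by auto
    have "dist (d m) (e j) < 1 / real (Suc j)"
      using e[of j] j(1) by (simp add: P_def)
    also have "\<dots> \<le> 1 / real (Suc M)"
      using \<open>j > M\<close> by (simp add: field_simps)
    finally have "e j \<in> ball x \<epsilon>"
      using m M dist_triangle2[of x "e j" "d m"] dist_triangle[of x "e j" "d m"]
      by (simp add: dist_commute)
    then show "\<exists>j. e j \<in> ball x \<epsilon> \<and> j \<notin> Z \<and> (\<forall>i\<in>X. coded_arc i j) \<and> (\<forall>i\<in>Y. coded_arc j i)"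
      using \<open>j \<notin> Z\<close> j by blast
  qed
qed

section \<open>Orientations and directed four-cycles\<close>

text \<open>Edges on which \<open>T\<close> is silent are directed along a well-order of the
  vertices.\<close>

lemma orientation_extending:
  fixes G :: "'a pair_pre_digraph"
  assumes irrefl: "\<And>u. (u, u) \<notin> parcs G" and sym: "\<And>u v. (u, v) \<in> parcs G \<Longrightarrow> (v, u) \<in> parcs G"
    and asym: "\<And>u v. T u v \<Longrightarrow> \<not> T v u"
  obtains D where "orientation_of D G" "\<And>u v. (u, v) \<in> parcs G \<Longrightarrow> T u v \<Longrightarrow> (u, v) \<in> parcs D"
proof -
  obtain r :: "'a rel" where r: "well_order_on UNIV r"
    using well_order_on by blast
  then have total: "(u, v) \<in> r \<or> (v, u) \<in> r" if "u \<noteq> v" for u v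
    using that by (auto simp: well_order_on_def linear_order_on_def total_on_def)
  have antisym: "\<not> ((u, v) \<in> r \<and> (v, u) \<in> r)" if "u \<noteq> v" for u v
    using r that by (auto simp: well_order_on_def linear_order_on_def partial_order_on_def antisym_def)
  define D where "D = \<lparr>pverts = pverts G,
    parcs = {(u, v) \<in> parcs G. T u v \<or> \<not> T v u \<and> (u, v) \<in> r}\<rparr>"
  show thesis
  proof (rule that)
    have "((u, v) \<in> parcs D) \<noteq> ((v, u) \<in> parcs D)" if uv: "(u, v) \<in> parcs G" for u v
    proof -
      have "u \<noteq> v"
        using uv irrefl by auto
      then show ?thesis
        using uv sym[OF uv] asym[of u v] total[of u v] antisym[of u v] by (auto simp: D_def)
    qed
    then show "orientation_of D G"
      by (auto simp: orientation_of_def D_def)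
    show "(u, v) \<in> parcs D" if "(u, v) \<in> parcs G" "T u v" for u v
      using that by (simp add: D_def)
  qed
qed

lemma four_cycle_in_induced:
  assumes "{v1, v2, v3, v4} \<subseteq> W" "distinct [v1, v2, v3, v4]"
    and "(v1, v2) \<in> parcs D" "(v2, v3) \<in> parcs D" "(v3, v4) \<in> parcs D" "(v4, v1) \<in> parcs D"
  shows "pre_digraph.cycle (with_proj D \<restriction> W) [(v1, v2), (v2, v3), (v3, v4), (v4, v1)]"
  unfolding pre_digraph.cycle_def
  by (rule exI[of _ v1])
    (use assms in \<open>simp add: eq_commute pre_digraph.awalk_def pre_digraph.cas.simps pre_digraph.awalk_verts.simps\<close>)

section \<open>Colour classes that contain four-cycles\<close>

definition richly_coloured :: "(nat \<Rightarrow> 'a::metric_space) \<Rightarrow> nat set \<Rightarrow> 'a set \<Rightarrow> bool" where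
  "richly_coloured e K U \<longleftrightarrow>
     infinite {j \<in> K. e j \<in> U} \<and>
     (\<forall>A. infinite A \<longrightarrow> (\<exists>a\<in>A. \<exists>a'\<in>A. \<exists>j\<in>K. \<exists>j'\<in>K. e j \<in> U \<and> e j' \<in> U \<and>
        coded_arc a j \<and> coded_arc j a' \<and> coded_arc a' j' \<and> coded_arc j' a))"

lemma richly_coloured_mono:
  assumes "richly_coloured e K U" "U \<subseteq> V"
  shows "richly_coloured e K V"
proof -
  have "{j \<in> K. e j \<in> U} \<subseteq> {j \<in> K. e j \<in> V}"
    using assms(2) by blast
  then have "infinite {j \<in> K. e j \<in> V}"
    using assms(1) finite_subset unfolding richly_coloured_def by blast
  then show ?thesis
    using assms unfolding richly_coloured_def by (meson subsetD)
qed

text \<open>A ball around a limit point contains a half-size ball around a nearby rich point, and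
  richness passes to larger sets.\<close>

lemma closed_richly_coloured:
  "closed {x. \<forall>\<epsilon>>0. richly_coloured e K (ball x \<epsilon>)}" (is "closed ?C")
proof -
  have "x \<in> ?C" if x: "x \<in> closure ?C" for x
  proof clarify
    fix \<epsilon> :: real assume "\<epsilon> > 0"
    then obtain y where "y \<in> ?C" "dist y x < \<epsilon> / 2"
      using x by (meson closure_approachable half_gt_zero)
    have "ball y (\<epsilon> / 2) \<subseteq> ball x \<epsilon>"
      using \<open>dist y x < \<epsilon> / 2\<close> dist_triangle_half_r[of y x \<epsilon>] by (auto simp: subset_iff)
    moreover have "richly_coloured e K (ball y (\<epsilon> / 2))"
      using \<open>y \<in> ?C\<close> \<open>\<epsilon> > 0\<close> by simp
    ultimately show "richly_coloured e K (ball x \<epsilon>)"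
      using richly_coloured_mono by blast
  qed
  then have "closure ?C \<subseteq> ?C"
    by blast
  then show ?thesis
    by (simp only: closure_subset_eq)
qed

text \<open>
  A colour that fails to be rich omits, locally, one of the two patterns \<open>u \<rightarrow> j \<rightarrow> v\<close> and \<open>v \<rightarrow> j \<rightarrow> u\<close>
  for any two elements \<open>u\<close>, \<open>v\<close> of some infinite set. Choosing disjoint pairs for the different colours
  combines these omissions into a single pattern that no colour realizes.
\<close>

lemma finite_pattern_avoiding_colours:
  assumes "finite B" and "\<And>c. c \<in> B \<Longrightarrow> \<exists>\<epsilon>>0. \<not> richly_coloured e (K c) (ball x \<epsilon>)"
  shows "\<exists>\<epsilon>>0. \<exists>X Y Z. finite X \<and> finite Y \<and> finite Z \<and> X \<inter> Y = {} \<and>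
    (\<forall>j. e j \<in> ball x \<epsilon> \<longrightarrow> j \<notin> Z \<longrightarrow> (\<forall>i\<in>X. coded_arc i j) \<longrightarrow> (\<forall>i\<in>Y. coded_arc j i) \<longrightarrow>
       (\<forall>c\<in>B. j \<notin> K c))"
  using assms
proof (induction B rule: finite_induct)
  case empty
  show ?case
    by (rule exI[of _ 1]) auto
next
  case (insert c B)
  obtain \<epsilon> X Y Z where \<epsilon>: "\<epsilon> > 0" and fin: "finite X" "finite Y" "finite Z" and disj: "X \<inter> Y = {}"
    and avoid: "\<And>j c. \<lbrakk>e j \<in> ball x \<epsilon>; j \<notin> Z; \<forall>i\<in>X. coded_arc i j; \<forall>i\<in>Y. coded_arc j i; c \<in> B\<rbrakk> \<Longrightarrow> j \<notin> K c"
    using insert.IH insert.prems by (metis insertCI)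
  obtain \<delta> where \<delta>: "\<delta> > 0" and bad: "\<not> richly_coloured e (K c) (ball x \<delta>)"
    using insert.prems by blast
  define \<eta> where "\<eta> = min \<epsilon> \<delta>"
  have \<eta>: "\<eta> > 0" "ball x \<eta> \<subseteq> ball x \<epsilon>" "ball x \<eta> \<subseteq> ball x \<delta>"
    using \<epsilon> \<delta> by (auto simp: \<eta>_def)
  show ?case
  proof (cases "finite {j \<in> K c. e j \<in> ball x \<delta>}")
    \<comment> \<open>A colour that occurs only finitely often near \<open>x\<close> is absorbed
      into the exceptional set.\<close>
    case True
    let ?Z = "Z \<union> {j \<in> K c. e j \<in> ball x \<delta>}"
    have avoid': "j \<notin> K c'" if "e j \<in> ball x \<eta>" "j \<notin> ?Z" "\<forall>i\<in>X. coded_arc i j" "\<forall>i\<in>Y. coded_arc j i"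
      "c' \<in> insert c B" for j c'
      using that \<eta> avoid[of j c'] by blast
    have "finite ?Z"
      using fin True by blast
    show ?thesis
      by (rule exI[of _ \<eta>], rule conjI[OF \<eta>(1)], rule exI[of _ X], rule exI[of _ Y], rule exI[of _ ?Z],
          intro conjI allI impI ballI; (fact | rule avoid'; assumption))
  next
    case False
    then obtain A where A: "infinite A" and none: "\<not> (\<exists>a\<in>A. \<exists>a'\<in>A. \<exists>j\<in>K c. \<exists>j'\<in>K c. e j \<in> ball x \<delta> \<and> e j' \<in> ball x \<delta> \<and>
        coded_arc a j \<and> coded_arc j a' \<and> coded_arc a' j' \<and> coded_arc j' a)"
      using bad unfolding richly_coloured_def by blast
    have "infinite (A - (X \<union> Y))"
      using A fin by (intro Diff_infinite_finite) auto
    \<comment> \<open>Choosing \<open>a\<close> and \<open>a'\<close> outside \<open>X\<close> and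
      \<open>Y\<close> keeps the enlarged patterns disjoint.\<close>
    then obtain a where a: "a \<in> A - (X \<union> Y)"
      by (metis ex_in_conv finite.emptyI)
    have "infinite (A - (X \<union> Y) - {a})"
      using \<open>infinite (A - (X \<union> Y))\<close> by simp
    then obtain a' where a': "a' \<in> A - (X \<union> Y)" "a' \<noteq> a"
      by (metis Diff_iff ex_in_conv finite.emptyI singletonI)
    \<comment> \<open>If some \<open>j\<close> of colour \<open>c\<close> realizes the path from
      \<open>a\<close> to \<open>a'\<close>, none realizes the way back, as the two would close a
      forbidden four-cycle. So at least one of the two orders works.\<close>
    obtain u v where uv: "u \<in> A - (X \<union> Y)" "v \<in> A - (X \<union> Y)" "u \<noteq> v"
      and no: "\<And>j. \<lbrakk>j \<in> K c; e j \<in> ball x \<delta>; coded_arc u j\<rbrakk> \<Longrightarrow> \<not> coded_arc j v"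
    proof (cases "\<exists>j\<in>K c. e j \<in> ball x \<delta> \<and> coded_arc a j \<and> coded_arc j a'")
      case True
      then show thesis
        using that[of a' a] a a' none by blast
    next
      case False
      then show thesis
        using that[of a a'] a a' by blast
    qed
    have avoid': "j \<notin> K c'" if "e j \<in> ball x \<eta>" "j \<notin> Z" "\<forall>i\<in>insert u X. coded_arc i j" "\<forall>i\<in>insert v Y. coded_arc j i"
      "c' \<in> insert c B" for j c'
      using that \<eta> no avoid[of j c'] by blast
    have "finite (insert u X)" "finite (insert v Y)" "insert u X \<inter> insert v Y = {}"
      using fin disj uv by auto
    show ?thesis
      by (rule exI[of _ \<eta>], rule conjI[OF \<eta>(1)], rule exI[of _ "insert u X"],
          rule exI[of _ "insert v Y"], rule exI[of _ Z],
          intro conjI allI impI ballI; (fact | rule avoid'; assumption))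
  qed
qed

section \<open>The lower bound for the Borsuk graph\<close>

theorem theorem7:
  fixes n :: nat and a :: real
  assumes "n \<ge> 1"
    and "CARD('d::finite) = n + 1"
    and "0 < a" and "a < 2"
  shows "graph_dichromatic_number (borsuk_graph a :: (real ^ 'd) pair_pre_digraph) \<ge> enat (n + 2)"
proof -
  let ?G = "borsuk_graph a :: (real ^ 'd) pair_pre_digraph"
  have dim: "DIM(real ^ 'd) = n + 1"
    using assms(2) by simp
  then obtain e :: "nat \<Rightarrow> real ^ 'd" where inj: "inj e" and e: "range e \<subseteq> sphere 0 1"
    and realizes: "\<And>x \<epsilon> X Y Z. \<lbrakk>x \<in> sphere 0 1; 0 < \<epsilon>; finite X; finite Y; finite Z; X \<inter> Y = {}\<rbrakk> \<Longrightarrow>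
       \<exists>j. e j \<in> ball x \<epsilon> \<and> j \<notin> Z \<and> (\<forall>i\<in>X. coded_arc i j) \<and> (\<forall>i\<in>Y. coded_arc j i)"
    using coded_sphere_sequence[where 'a="real ^ 'd"] assms(1) by auto
  have e_norm: "norm (e i) = 1" for i
    using e by (auto simp: image_subset_iff)
  define T where "T u v \<longleftrightarrow> (\<exists>i j. u = e i \<and> v = e j \<and> coded_arc i j)" for u v
  have "T u v \<Longrightarrow> \<not> T v u" for u v
    using coded_arc_asym inj by (auto simp: T_def inj_eq)
  then obtain D where D: "orientation_of D ?G" and "\<And>u v. (u, v) \<in> parcs ?G \<Longrightarrow> T u v \<Longrightarrow> (u, v) \<in> parcs D"
    using orientation_extending[of ?G T] assms(3)
    by (auto simp: borsuk_graph_def norm_minus_commute)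
  then have arc: "(e i, e j) \<in> parcs D" if "coded_arc i j" "norm (e j - e i) \<ge> a" for i j
    using that e_norm by (auto simp: borsuk_graph_def T_def)
  have verts_D: "pverts D = sphere 0 1"
    using D by (simp add: orientation_of_def borsuk_graph_def)
  have "enat (n + 2) \<le> enat k" if col: "proper_dicolouring (with_proj D) k f" for k f
  proof (rule ccontr)
    assume "\<not> ?thesis"
    then have k: "k \<le> n + 1"
      by simp
    have f: "f (e j) \<in> {1..k}" for j
      using col e_norm verts_D by (auto simp: proper_dicolouring_def)
    \<comment> \<open>Colours start at 1, the closed sets at 0. If k < n + 1, the classes
      \<open>K c\<close> with \<open>c\<close> at least k are empty.\<close>
    define K where "K c = {j. f (e j) = Suc c}" for c
    define C where "C c = {x. \<forall>\<epsilon>>0. richly_coloured e (K c) (ball x \<epsilon>)}" for c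
    have "x \<in> (\<Union>c<DIM(real ^ 'd). C c)" if x: "x \<in> sphere 0 1" for x
    proof (rule ccontr)
      assume "\<not> ?thesis"
      \<comment> \<open>If no colour were rich at \<open>x\<close>, one finite pattern would be
        avoided by all colours near \<open>x\<close>, yet universality supplies a point there
        realizing it.\<close>
      then have "\<exists>\<epsilon>>0. \<not> richly_coloured e (K c) (ball x \<epsilon>)" if "c \<in> {..n}" for c
        using that dim by (auto simp: C_def)
      then obtain \<epsilon> X Y Z where *: "\<epsilon> > 0" "finite X" "finite Y" "finite Z" "X \<inter> Y = {}"
        and avoid: "\<And>j. \<lbrakk>e j \<in> ball x \<epsilon>; j \<notin> Z; \<forall>i\<in>X. coded_arc i j; \<forall>i\<in>Y. coded_arc j i\<rbrakk> \<Longrightarrow> \<forall>c\<in>{..n}. j \<notin> K c"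
        using finite_pattern_avoiding_colours[of "{..n}" e K x] by (metis finite_atMost)
      obtain j where "\<forall>c\<in>{..n}. j \<notin> K c"
        using realizes[OF x *] avoid by blast
      moreover have "f (e j) - 1 \<in> {..n}" "j \<in> K (f (e j) - 1)"
        using f[of j] k by (auto simp: K_def)
      ultimately show False
        by blast
    qed
    then have cover: "sphere 0 1 \<subseteq> (\<Union>c<DIM(real ^ 'd). C c)"
      by blast
    have closed: "closed (C c)" for c
      unfolding C_def by (rule closed_richly_coloured)
    obtain c x where "c < DIM(real ^ 'd)" and x: "x \<in> sphere 0 1" "x \<in> C c" "- x \<in> C c"
      by (rule Lusternik_Schnirelmann[OF closed cover])
    \<comment> \<open>Points in balls of this radius around antipodes are at distance at least 2 -
      (2 - a) = a.\<close>
    define \<epsilon> where "\<epsilon> = (2 - a) / 2"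
    have "\<epsilon> > 0"
      using assms(4) by (simp add: \<epsilon>_def)
    have far: "norm (u - v) \<ge> a" "norm (v - u) \<ge> a" if "u \<in> ball x \<epsilon>" "v \<in> ball (- x) \<epsilon>" for u v
    proof -
      have "2 = norm (x - (- x))"
        using x(1) by (simp flip: scaleR_2)
      also have "x - (- x) = (x - u) + (u - v) + (v - (- x))"
        by simp
      also have "norm \<dots> \<le> norm (x - u) + norm (u - v) + norm (v - (- x))"
        by (intro norm_triangle_mono order_refl)
      also have "\<dots> \<le> \<epsilon> + norm (u - v) + \<epsilon>"
        using that by (auto simp: dist_norm norm_minus_commute)
      finally show "norm (u - v) \<ge> a" "norm (v - u) \<ge> a"
        by (auto simp: \<epsilon>_def norm_minus_commute field_simps)
    qed
    define A where "A = {j \<in> K c. e j \<in> ball (- x) \<epsilon>}"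
    have "infinite A"
      using x(3) \<open>\<epsilon> > 0\<close> by (auto simp: C_def richly_coloured_def A_def)
    \<comment> \<open>The cycle alternates between the balls around \<open>- x\<close> and
      \<open>x\<close>, so each of its arcs joins points far enough apart to be adjacent.\<close>
    then obtain p q r s where in_A: "p \<in> A" "r \<in> A" and in_K: "q \<in> K c" "s \<in> K c"
      and ball: "e q \<in> ball x \<epsilon>" "e s \<in> ball x \<epsilon>"
      and arcs: "coded_arc p q" "coded_arc q r" "coded_arc r s" "coded_arc s p"
      using x(2) \<open>\<epsilon> > 0\<close> unfolding C_def richly_coloured_def by blast
    \<comment> \<open>Opposite vertices differ because \<open>coded_arc\<close> is asymmetric:
      \<open>p\<close> points to \<open>q\<close>, whereas \<open>q\<close> points to
      \<open>r\<close>.\<close>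
    have "distinct [e p, e q, e r, e s]"
      using arcs coded_arc_asym inj by (auto simp: inj_eq)
    then have "pre_digraph.cycle (with_proj D \<restriction> {v \<in> verts (with_proj D). f v = Suc c})
        [(e p, e q), (e q, e r), (e r, e s), (e s, e p)]"
      using in_A in_K ball arcs far e_norm verts_D
      by (intro four_cycle_in_induced arc) (auto simp: A_def K_def)
    moreover have "Suc c \<in> {1..k}"
      using f[of q] in_K by (simp add: K_def)
    ultimately show False
      using col unfolding proper_dicolouring_def by blast
  qed
  then have "enat (n + 2) \<le> dichromatic_number (with_proj D)"
    unfolding dichromatic_number_def by (intro INF_greatest) blast
  also have "\<dots> \<le> graph_dichromatic_number ?G"
    unfolding graph_dichromatic_number_def using D by (intro SUP_upper) simp
  finally show ?thesis .
qed

end
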